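(* Let $\mathrm{Proc}$ be a set of processes, let $\mathsf{Obs}$ be a set (of observations), and let $O:\mathsf{Obs}\to\mathcal P(\mathrm{Proc})$ be a map such that $\mathcal B_G=\{O(o)\mid o\in\mathsf{Obs}\}$ is a basis for a topology $\tau_G$ on $\mathrm{Proc}$. Then a property $L\subseteq\mathrm{Proc}$ is $\mathcal B_G$-verifiable if and only if $L\in\tau_G$.
   Context: Let $L\subseteq\mathrm{Proc}$. A $\mathcal B_G$-verifier for $L$ is a function $v:\mathsf{Obs}\to\{\mathsf{yes},\mathsf{?}\}$ such that for all $o,o'\in\mathsf{Obs}$: (i) (soundness) if $v(o)=\mathsf{yes}$ then $O(o)\subseteq L$; (ii) (monotonicity) if $v(o)=\mathsf{yes}$ and $O(o')\subseteq O(o)$ then $v(o')=\mathsf{yes}$. $L$ is $\mathcal B_G$-verifiable if there exists a $\mathcal B_G$-verifier $v$ for $L$ such that for every $p\in L$ there is $o\in\mathsf{Obs}$ with $p\in O(o)$ and $v(o)=\mathsf{yes}$. *)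

theory Defs
  imports "HOL-Analysis.Analysis"
begin

(* The analogue, for the type of abstract topologies, of the type-class notion topological_basis. *)
definition basis_of_topology :: "'a set set \<Rightarrow> 'a topology \<Rightarrow> bool" where
  "basis_of_topology \<B> X \<longleftrightarrow>
     (\<forall>b\<in>\<B>. openin X b) \<and> (\<forall>U. openin X U \<longrightarrow> (\<exists>\<B>'. \<B>' \<subseteq> \<B> \<and> \<Union>\<B>' = U))"

datatype verdict = Yes | Unknown

(* A verifier Obs -> {yes, ?} is a total function on the ambient type; every condition
   below only looks at its values on Obs. *)
definition is_verifier ::
    "'obs set \<Rightarrow> ('obs \<Rightarrow> 'p set) \<Rightarrow> 'p set \<Rightarrow> ('obs \<Rightarrow> verdict) \<Rightarrow> bool" where
  "is_verifier Obs \<O> L v \<longleftrightarrow>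
     (\<forall>x\<in>Obs. v x = Yes \<longrightarrow> \<O> x \<subseteq> L) \<and>
     (\<forall>x\<in>Obs. \<forall>y\<in>Obs. v x = Yes \<and> \<O> y \<subseteq> \<O> x \<longrightarrow> v y = Yes)"

definition verifiable :: "'obs set \<Rightarrow> ('obs \<Rightarrow> 'p set) \<Rightarrow> 'p set \<Rightarrow> bool" where
  "verifiable Obs \<O> L \<longleftrightarrow>
     (\<exists>v. is_verifier Obs \<O> L v \<and> (\<forall>p\<in>L. \<exists>x\<in>Obs. p \<in> \<O> x \<and> v x = Yes))"

end

theory Submission
  imports Defs
begin

text \<open>A verifier that confirms every process of \<open>L\<close> presents \<open>L\<close> as
  a union of the basic open sets it accepts, so \<open>L\<close> is open. Conversely, for an open
  \<open>L\<close> the verifier that says \<open>Yes\<close> exactly on basic sets inside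
  \<open>L\<close> misses no process, since \<open>L\<close> is a union of basic sets.\<close>

theorem theorem5p4:
  fixes Proc :: "'p set"
    and Obs :: "'obs set"
    and \<O> :: "'obs \<Rightarrow> 'p set"
    and \<tau>\<^sub>G :: "'p topology"
    and L :: "'p set"
  assumes "\<O> \<in> Obs \<rightarrow> Pow Proc"
    and "topspace \<tau>\<^sub>G = Proc"
    and "basis_of_topology (\<O> ` Obs) \<tau>\<^sub>G"
    and "L \<subseteq> Proc"
  shows "verifiable Obs \<O> L \<longleftrightarrow> openin \<tau>\<^sub>G L"
proof
  assume "verifiable Obs \<O> L"
  then obtain v where v: "is_verifier Obs \<O> L v"
    and complete: "\<forall>p\<in>L. \<exists>x\<in>Obs. p \<in> \<O> x \<and> v x = Yes"
    unfolding verifiable_def by blast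
  \<comment> \<open>Soundness keeps the union inside \<open>L\<close>; completeness makes it cover
    \<open>L\<close>.\<close>
  have "L = (\<Union>x\<in>{x \<in> Obs. v x = Yes}. \<O> x)"
    using v complete unfolding is_verifier_def by blast
  moreover have "openin \<tau>\<^sub>G (\<O> x)" if "x \<in> Obs" for x
    using assms(3) that unfolding basis_of_topology_def by blast
  ultimately show "openin \<tau>\<^sub>G L"
    by auto
next
  assume "openin \<tau>\<^sub>G L"
  then obtain \<B>' where \<B>': "\<B>' \<subseteq> \<O> ` Obs" "\<Union>\<B>' = L"
    using assms(3) unfolding basis_of_topology_def by blast
  \<comment> \<open>The most permissive sound choice; it is monotone because inclusion is
    transitive.\<close>
  define v where "v x = (if \<O> x \<subseteq> L then Yes else Unknown)" for x
  have v_iff: "v x = Yes \<longleftrightarrow> \<O> x \<subseteq> L" for x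
    by (simp add: v_def)
  have "is_verifier Obs \<O> L v"
    unfolding is_verifier_def v_iff by blast
  \<comment> \<open>A member of \<open>\<B>'\<close> containing \<open>p\<close> is some
    \<open>\<O> x\<close> with \<open>x\<close> in \<open>Obs\<close>, and it lies inside the union
    \<open>L\<close>, so \<open>v\<close> accepts it.\<close>
  moreover have "\<forall>p\<in>L. \<exists>x\<in>Obs. p \<in> \<O> x \<and> v x = Yes"
    unfolding v_iff using \<B>' by blast
  ultimately show "verifiable Obs \<O> L"
    unfolding verifiable_def by blast
qed

end
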